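(* Let $m>1$ and $n\ge1$ be integers, and let $SF(n,m)$ be the set of semi-$m$-Fibonacci partitions of $n$ (defined in the context). For a positive integer $N$, let $x_m(N)=m^s$ where $s\ge0$ is the largest integer with $m^s\mid N$. Then a partition $\lambda$ of $n$ belongs to $SF(n,m)$ if and only if the parts of $\lambda$ have pairwise distinct values of $x_m$ and at most one part of $\lambda$ is not a multiple of $m$.
   Context: For fixed $m>1$, the sets $SF(n,m)$ of partitions of $n$ ($n\ge1$) are defined recursively: $SF(n,m)=\{(n)\}$ for $n=1,\dots,m$. If $n>m$ and $m\mid n$, then $SF(n,m)$ consists of the partitions obtained from the partitions in $SF(n/m,m)$ by multiplying every part by $m$. If $n>m$ and $n\equiv r\pmod m$ with $1\le r\le m-1$, then $SF(n,m)$ consists of (a) the partitions obtained by inserting a part $r$ into a partition of $SF(n-r,m)$, together with (b) the partitions obtained from a partition $\lambda\in SF(n-m,m)$ by adding $m$ to the single part of $\lambda$ that is congruent to $r$ modulo $m$ (each such $\lambda$ has exactly one such part). *)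

theory Defs
  imports "HOL-Computational_Algebra.Factorial_Ring" "HOL-Number_Theory.Cong"
begin

definition partition_of :: "nat multiset \<Rightarrow> nat \<Rightarrow> bool" where
  "partition_of l n \<longleftrightarrow> (\<forall>p\<in>#l. p > 0) \<and> sum_mset l = n"

text \<open>
  Sets of semi-\<open>m\<close>-Fibonacci partitions, as multisets of parts. The first branch only totalises
  the function outside \<open>n \<ge> 1\<close>, \<open>m > 1\<close>. In the last branch \<open>p\<close> ranges over all parts congruent to
  \<open>r\<close>; by the lemma \<open>SF_unique_part\<close> below there is exactly one of them, so this is
  ``the single part of \<open>l\<close> congruent to \<open>r\<close>''.
\<close>

function SF :: "nat \<Rightarrow> nat \<Rightarrow> nat multiset set" where
  "SF n m =
    (if n = 0 \<or> m \<le> 1 then {}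
     else if n \<le> m then {{#n#}}
     else if m dvd n then image_mset (\<lambda>p. m * p) ` SF (n div m) m
     else (let r = n mod m in
       add_mset r ` SF (n - r) m \<union>
       {add_mset (p + m) (l - {#p#}) | l p. l \<in> SF (n - m) m \<and> p \<in># l \<and> [p = r] (mod m)}))"
  by pat_completeness auto
termination
  by (relation "measure fst") (auto simp: dvd_eq_mod_eq_0)

declare SF.simps [simp del]

lemma SF_partition_of: "l \<in> SF n m \<Longrightarrow> partition_of l n"
proof (induction n m arbitrary: l rule: SF.induct)
  case (1 n m)
  show ?case
  proof (cases "n = 0 \<or> m \<le> 1 \<or> n \<le> m")
    case True
    then show ?thesis using "1.prems" by (auto simp: SF.simps[of n m] partition_of_def split: if_splits)
  next
    case nb: False
    show ?thesis
    proof (cases "m dvd n")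
      case True
      then obtain l' where l': "l' \<in> SF (n div m) m" "l = image_mset (\<lambda>p. m * p) l'"
        using "1.prems" nb by (auto simp: SF.simps[of n m])
      have "partition_of l' (n div m)" using "1.IH"(1) nb True l' by auto
      then show ?thesis using l'(2) nb True
        by (auto simp: partition_of_def simp flip: sum_mset_distrib_left)
    next
      case False
      have IH2: "partition_of l' (n - n mod m)" if "l' \<in> SF (n - n mod m) m" for l'
        using "1.IH"(2) nb False that by auto
      have IH3: "partition_of l' (n - m)" if "l' \<in> SF (n - m) m" for l'
        using "1.IH"(3) nb False that by auto
      have r: "n mod m > 0" "n mod m \<le> n" using False by (auto simp: dvd_eq_mod_eq_0)
      consider l' where "l' \<in> SF (n - n mod m) m" "l = add_mset (n mod m) l'"
        | l' p where "l' \<in> SF (n - m) m" "p \<in># l'" "l = add_mset (p + m) (l' - {#p#})"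
        using "1.prems" nb False by (auto simp: SF.simps[of n m] Let_def)
      then show ?thesis
      proof cases
        case 1
        then show ?thesis using IH2[OF 1(1)] r by (auto simp: partition_of_def)
      next
        case 2
        then obtain k where "l' = add_mset p k" by (metis insert_DiffM)
        then show ?thesis using IH3[OF 2(1)] 2(3) nb by (auto simp: partition_of_def)
      qed
    qed
  qed
qed

lemma SF_dvd_parts:
  assumes "m dvd n" "l \<in> SF n m" "p \<in># l"
  shows "m dvd p"
proof -
  have "n = m" if "n > 0" "n \<le> m" using assms(1) that by (auto dest: dvd_imp_le)
  then show ?thesis using assms by (auto simp: SF.simps[of n m] split: if_splits)
qed

lemma SF_unique_part:
  assumes "\<not> m dvd n" "l \<in> SF n m"
  shows "size (filter_mset (\<lambda>p. [p = n mod m] (mod m)) l) = 1"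
  using assms
proof (induction n m arbitrary: l rule: SF.induct)
  case (1 n m)
  show ?case
  proof (cases "n = 0 \<or> m \<le> 1 \<or> n \<le> m")
    case True
    then show ?thesis using "1.prems"
      by (auto simp: SF.simps[of n m] cong_def split: if_splits)
  next
    case nb: False
    have mm: "(n - m) mod m = n mod m" "\<not> m dvd n - m" using nb "1.prems"(1)
      by (auto simp: le_mod_geq dvd_eq_mod_eq_0)
    have IH3: "size (filter_mset (\<lambda>p. [p = n mod m] (mod m)) l') = 1" if "l' \<in> SF (n - m) m" for l'
      using "1.IH"(3)[OF _ _ _ refl, of l'] nb "1.prems"(1) that mm by auto
    have r: "n mod m > 0" using "1.prems"(1) by (auto simp: dvd_eq_mod_eq_0)
    consider l' where "l' \<in> SF (n - n mod m) m" "l = add_mset (n mod m) l'"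
      | l' p where "l' \<in> SF (n - m) m" "p \<in># l'" "[p = n mod m] (mod m)"
        "l = add_mset (p + m) (l' - {#p#})"
      using "1.prems" nb by (auto simp: SF.simps[of n m] Let_def)
    then show ?thesis
    proof cases
      case 1
      have "m dvd p" if "p \<in># l'" for p
        by (rule SF_dvd_parts[OF _ 1(1) that]) (simp add: dvd_minus_mod)
      then have "filter_mset (\<lambda>p. [p = n mod m] (mod m)) l' = {#}"
        using r by (intro multiset_eqI) (auto simp: cong_def dvd_eq_mod_eq_0 not_in_iff[symmetric])
      then show ?thesis using 1(2) by simp
    next
      case 2
      then obtain k where k: "l' = add_mset p k" by (metis insert_DiffM)
      have "[p + m = n mod m] (mod m)" using 2(3) by (simp add: cong_def)
      then show ?thesis using IH3[OF 2(1)] 2(3,4) k by simp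
    qed
  qed
qed

text \<open>
  The library's \<open>multiplicity m N\<close> is the maximum of \<open>{s. m ^ s dvd N}\<close> whenever this set is finite,
  hence for all \<open>m > 1\<close>, \<open>N > 0\<close>; the base \<open>m\<close> need not be prime.
\<close>

definition x_val :: "nat \<Rightarrow> nat \<Rightarrow> nat" where
  "x_val m N = m ^ multiplicity m N"

end

theory Submission
  imports Defs
begin

text \<open>
  Both sides satisfy the same recursion in \<open>n\<close>. Since \<open>x_m\<close> takes the value 1 exactly on the
  non-multiples of \<open>m\<close>, distinctness of its values already forces at most one such part.
  If \<open>m\<close> divides \<open>n\<close>, a sole non-multiple cannot occur, so every part is a multiple of \<open>m\<close> and
  dividing by \<open>m\<close> rescales all values of \<open>x_m\<close> by the same factor. Otherwise there is exactly one
  non-multiple \<open>p\<close>, congruent to \<open>n\<close>; changing it modulo \<open>m\<close>, or removing it, does not affect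
  distinctness, and the two cases \<open>p < m\<close> and \<open>p > m\<close> are the two clauses of the definition.
\<close>

section \<open>Distinctness of the values \<open>x_val m p\<close>\<close>

text \<open>Counting in the multiset of values makes two equal parts clash as well; a condition on
  the set of parts would miss repetitions.\<close>

definition x_distinct :: "nat \<Rightarrow> nat multiset \<Rightarrow> bool" where
  "x_distinct m l \<longleftrightarrow> (\<forall>v. count (image_mset (x_val m) l) v \<le> 1)"

lemma x_val_eq_1_iff:
  assumes "m > 1" "p > 0"
  shows "x_val m p = 1 \<longleftrightarrow> \<not> m dvd p"
  using assms by (auto simp: x_val_def multiplicity_eq_zero_iff)

lemma x_val_times:
  assumes "m > 1" "p > 0"
  shows "x_val m (m * p) = m * x_val m p"
  using assms by (simp add: x_val_def multiplicity_times_same)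

text \<open>The values are all multiplied by \<open>m\<close>, and this map is injective, so
  multiplicities of values are only relabelled.\<close>

lemma x_distinct_times:
  assumes "m > 1" "\<forall>p\<in>#l. p > 0"
  shows "x_distinct m (image_mset ((*) m) l) \<longleftrightarrow> x_distinct m l"
proof -
  let ?A = "image_mset (x_val m) l"
  have eq: "image_mset (x_val m) (image_mset ((*) m) l) = image_mset ((*) m) ?A"
    using assms by (auto simp: multiset.map_comp comp_def x_val_times intro: image_mset_cong)
  have cnt: "count (image_mset ((*) m) ?A) (m * v) = count ?A v" for v
    using assms(1) by (induction l) auto
  \<comment> \<open>\<open>x_distinct\<close> quantifies over every \<open>v\<close>, so the values
    outside the range of multiplication by \<open>m\<close> are settled separately.\<close>
  have "count (image_mset ((*) m) ?A) v = 0" if "v \<notin> range ((*) m)" for v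
    using that by (auto simp flip: not_in_iff)
  then show ?thesis
    unfolding x_distinct_def eq using cnt by (metis imageE zero_le)
qed

text \<open>The value 1 of \<open>p\<close> is taken by no multiple of \<open>m\<close>. Used in
  both directions, this lets the sole non-multiple be inserted, removed or exchanged for
  another.\<close>

lemma x_distinct_add_nondvd:
  assumes "m > 1" "\<not> m dvd p" "\<forall>q\<in>#l. q > 0 \<and> m dvd q"
  shows "x_distinct m (add_mset p l) \<longleftrightarrow> x_distinct m l"
proof -
  \<comment> \<open>Here \<open>p > 0\<close> because \<open>m\<close> divides 0.\<close>
  have p: "x_val m p = 1" using assms(1,2) by (intro x_val_eq_1_iff[THEN iffD2]) (auto intro: Nat.gr0I)
  have "1 \<notin># image_mset (x_val m) l"
    using assms(1,3) x_val_eq_1_iff[OF assms(1)] by (metis image_iff set_image_mset)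
  then have c: "count (image_mset (x_val m) l) 1 = 0" by (simp only: not_in_iff)
  have "count (image_mset (x_val m) (add_mset p l)) v \<le> 1 \<longleftrightarrow> count (image_mset (x_val m) l) v \<le> 1"
    for v using p c by (cases "v = 1") simp_all
  then show ?thesis unfolding x_distinct_def by blast
qed

text \<open>Two non-multiples, even equal ones, would both have value 1.\<close>

lemma x_distinct_nondvd_unique:
  assumes "m > 1" "x_distinct m (add_mset p l)" "p > 0" "\<not> m dvd p" "q \<in># l" "q > 0"
  shows "m dvd q"
proof (rule ccontr)
  assume "\<not> m dvd q"
  obtain k where "l = add_mset q k" using assms(5) by (metis insert_DiffM)
  moreover have "x_val m p = 1" "x_val m q = 1"
    using x_val_eq_1_iff assms \<open>\<not> m dvd q\<close> by blast+
  ultimately have "count (image_mset (x_val m) (add_mset p l)) 1 \<ge> 2" by simp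
  moreover have "count (image_mset (x_val m) (add_mset p l)) 1 \<le> 1"
    using assms(2) unfolding x_distinct_def by blast
  ultimately show False by linarith
qed

section \<open>Non-multiples of \<open>m\<close> and the residue of the sum\<close>

lemma dvd_sum_mset:
  assumes "\<forall>q\<in>#l. (m::nat) dvd q"
  shows "m dvd sum_mset l"
  using assms by (induction l) auto

text \<open>A non-multiple would be the only one, so it would equal \<open>n\<close> minus a sum of
  multiples of \<open>m\<close>.\<close>

lemma x_distinct_all_dvd:
  assumes "m > 1" "x_distinct m l" "partition_of l n" "m dvd n" "p \<in># l"
  shows "m dvd p"
proof (rule ccontr)
  assume np: "\<not> m dvd p"
  obtain k where k: "l = add_mset p k" using assms(5) by (metis insert_DiffM)
  have "\<forall>q\<in>#k. m dvd q"
    using x_distinct_nondvd_unique[OF assms(1)] assms(2,3) np k by (auto simp: partition_of_def)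
  then have "m dvd sum_mset k" by (rule dvd_sum_mset)
  moreover have "n = p + sum_mset k" using assms(3) k by (simp add: partition_of_def)
  ultimately show False using np assms(4) by (simp add: dvd_add_left_iff)
qed

text \<open>If all parts were multiples of \<open>m\<close>, so would be \<open>n\<close>; once one
  non-multiple is split off, the rest vanishes modulo \<open>m\<close>.\<close>

lemma x_distinct_nondvd_obtain:
  assumes "m > 1" "x_distinct m l" "partition_of l n" "\<not> m dvd n"
  obtains p k where "l = add_mset p k" "\<not> m dvd p" "p > 0" "\<forall>q\<in>#k. q > 0 \<and> m dvd q"
    "n = p + sum_mset k" "[p = n] (mod m)"
proof -
  obtain p where p: "p \<in># l" "\<not> m dvd p"
    using dvd_sum_mset[of l m] assms(3,4) by (auto simp: partition_of_def)
  then obtain k where k: "l = add_mset p k" by (metis insert_DiffM)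
  have pos: "p > 0" "\<forall>q\<in>#k. q > 0" and n: "n = p + sum_mset k"
    using assms(3) k by (auto simp: partition_of_def)
  have dvd: "\<forall>q\<in>#k. m dvd q"
    using x_distinct_nondvd_unique[OF assms(1)] assms(2) p k pos by blast
  have "[p = n] (mod m)"
    using dvd_sum_mset[OF dvd] n by (auto simp: cong_def elim!: dvdE)
  then show thesis using that p k pos n dvd by blast
qed

section \<open>The recursion for \<open>SF\<close>, rearranged\<close>

lemma SF_less: "0 < n \<Longrightarrow> n < m \<Longrightarrow> SF n m = {{#n#}}"
  by (simp add: SF.simps)

text \<open>This absorbs the initial value \<open>n = m\<close> into the multiplication clause,
  since \<open>{#m#}\<close> is \<open>m\<close> times the only element of \<open>SF 1 m\<close>.
  Only \<open>n < m\<close> remains as a base case.\<close>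

lemma SF_dvd:
  assumes "m > 1" "n > 0" "m dvd n"
  shows "SF n m = image_mset ((*) m) ` SF (n div m) m"
proof (cases "n \<le> m")
  case True
  then have "n = m" using assms by (auto dest: dvd_imp_le)
  then show ?thesis using assms by (simp add: SF.simps[of m m] SF.simps[of "Suc 0" m])
qed (use assms in \<open>simp add: SF.simps[of n m]\<close>)

text \<open>Writing the old partition as \<open>add_mset p k\<close> replaces multiset subtraction
  by a decomposition that fits the lemmas on \<open>x_distinct\<close>.\<close>

lemma SF_not_dvd:
  assumes "m > 1" "n > m" "\<not> m dvd n"
  shows "l \<in> SF n m \<longleftrightarrow>
    (\<exists>k \<in> SF (n - n mod m) m. l = add_mset (n mod m) k) \<or>
    (\<exists>p k. add_mset p k \<in> SF (n - m) m \<and> [p = n] (mod m) \<and> l = add_mset (p + m) k)"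
proof -
  have "(\<exists>l' p. l = add_mset (p + m) (l' - {#p#}) \<and> l' \<in> SF (n - m) m \<and> p \<in># l' \<and> [p = n] (mod m))
    \<longleftrightarrow> (\<exists>p k. add_mset p k \<in> SF (n - m) m \<and> [p = n] (mod m) \<and> l = add_mset (p + m) k)"
    by (metis add_mset_remove_trivial insert_DiffM union_single_eq_member)
  moreover have "SF n m = add_mset (n mod m) ` SF (n - n mod m) m \<union>
       {add_mset (p + m) (l - {#p#}) | l p. l \<in> SF (n - m) m \<and> p \<in># l \<and> [p = n] (mod m)}"
    using assms by (subst SF.simps) (simp add: Let_def cong_def)
  ultimately show ?thesis by auto
qed

section \<open>The equivalence, by strong induction on \<open>n\<close>\<close>

lemma SF_iff_x_distinct:
  assumes "m > 1" "n > 0" "partition_of l n"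
  shows "l \<in> SF n m \<longleftrightarrow> x_distinct m l"
  using assms(2,3)
proof (induction n arbitrary: l rule: less_induct)
  case (less n)
  note m = \<open>m > 1\<close>
  have pos: "\<forall>p\<in>#l. p > 0" and sum: "sum_mset l = n"
    using less.prems by (auto simp: partition_of_def)
  consider "m dvd n" | "\<not> m dvd n" "n < m" | "\<not> m dvd n" "n > m"
    by (metis dvd_refl linorder_less_linear)
  then show ?case
  proof cases
    case 1
    have n': "n div m > 0" "n div m < n" using 1 m less.prems(1) by (auto elim!: dvdE)
    have iff: "k \<in> SF (n div m) m \<longleftrightarrow> x_distinct m k" if "partition_of k (n div m)" for k
      using less.IH n' that by blast
    show ?thesis
    proof
      assume "l \<in> SF n m"
      then obtain k where k: "k \<in> SF (n div m) m" "l = image_mset ((*) m) k"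
        using SF_dvd m less.prems(1) 1 by blast
      have pk: "partition_of k (n div m)" using k(1) by (rule SF_partition_of)
      then show "x_distinct m l"
        using iff[OF pk] k x_distinct_times[OF m] by (auto simp: partition_of_def)
    next
      assume D: "x_distinct m l"
      \<comment> \<open>The candidate preimage under multiplication by \<open>m\<close>; it is exact
        because every part is a multiple of \<open>m\<close>.\<close>
      define k where "k = image_mset (\<lambda>p. p div m) l"
      have dvd: "m dvd p" if "p \<in># l" for p
        using x_distinct_all_dvd[OF m D less.prems(2) 1 that] .
      have "image_mset (\<lambda>p. m * (p div m)) l = image_mset (\<lambda>p. p) l"
        by (rule image_mset_cong) (simp add: dvd)
      then have l: "l = image_mset ((*) m) k"
        by (simp add: k_def multiset.map_comp comp_def)
      have kpos: "\<forall>p\<in>#k. p > 0" using pos l by auto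
      have "n = m * sum_mset k" using sum l sum_mset_distrib_left[of m "\<lambda>p. p" k] by simp
      then have "partition_of k (n div m)" using kpos m by (simp add: partition_of_def)
      then have "k \<in> SF (n div m) m"
        using iff D x_distinct_times[OF m kpos] l by simp
      then show "l \<in> SF n m" using SF_dvd m less.prems(1) 1 l by blast
    qed
  next
    case 2
    show ?thesis
    proof
      assume "l \<in> SF n m"
      then show "x_distinct m l" using SF_less 2 less.prems(1) by (auto simp: x_distinct_def)
    next
      assume "x_distinct m l"
      then obtain p k where k: "l = add_mset p k" "\<forall>q\<in>#k. q > 0 \<and> m dvd q" "n = p + sum_mset k"
        using x_distinct_nondvd_obtain[OF m _ less.prems(2) 2(1)] by metis
      \<comment> \<open>A further part would be a positive multiple of \<open>m\<close>, hence at
        least \<open>m\<close>, exceeding \<open>n\<close>.\<close>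
      have "k = {#}"
      proof (rule ccontr)
        assume "k \<noteq> {#}"
        then obtain q where "q \<in># k" by auto
        then have "m \<le> q" "q \<le> sum_mset k"
          using k(2) by (auto intro: dvd_imp_le dest!: multi_member_split)
        then show False using k(3) 2(2) by simp
      qed
      then show "l \<in> SF n m" using SF_less 2 less.prems(1) k by simp
    qed
  next
    case 3
    let ?r = "n mod m"
    have r: "\<not> m dvd ?r" "?r > 0" "?r < m" using 3 m by (auto simp: dvd_mod_iff intro: Nat.gr0I)
    have iff1: "k \<in> SF (n - ?r) m \<longleftrightarrow> x_distinct m k" if "partition_of k (n - ?r)" for k
      using less.IH[of "n - ?r"] r 3 that by simp
    have iff2: "k \<in> SF (n - m) m \<longleftrightarrow> x_distinct m k" if "partition_of k (n - m)" for k
      using less.IH[of "n - m"] 3 m that by simp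
    show ?thesis
    proof
      assume "l \<in> SF n m"
      then consider k where "k \<in> SF (n - ?r) m" "l = add_mset ?r k"
        | p k where "add_mset p k \<in> SF (n - m) m" "[p = n] (mod m)" "l = add_mset (p + m) k"
        using SF_not_dvd[OF m 3(2,1)] by blast
      then show "x_distinct m l"
      proof cases
        case k: 1
        \<comment> \<open>\<open>m\<close> divides \<open>n - ?r\<close>, so every partition in that
          set consists of multiples of \<open>m\<close>.\<close>
        have "\<forall>q\<in>#k. q > 0 \<and> m dvd q"
          using SF_dvd_parts[OF _ k(1)] SF_partition_of[OF k(1)]
          by (auto simp: partition_of_def dvd_minus_mod)
        then show ?thesis
          using x_distinct_add_nondvd[OF m r(1)] iff1 k SF_partition_of by blast
      next
        case k: 2
        have part: "partition_of (add_mset p k) (n - m)" using k(1) by (rule SF_partition_of)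
        then have D: "x_distinct m (add_mset p k)" using iff2 k(1) by blast
        have np: "\<not> m dvd p" using k(2) 3(1) cong_dvd_iff by blast
        have "\<forall>q\<in>#k. q > 0 \<and> m dvd q"
          using x_distinct_nondvd_unique[OF m D _ np] part by (auto simp: partition_of_def)
        \<comment> \<open>Distinctness passes from \<open>add_mset p k\<close> down to
          \<open>k\<close> and up again with \<open>p + m\<close>, which is still a
          non-multiple.\<close>
        then show ?thesis using D np k(3) x_distinct_add_nondvd[OF m] by simp
      qed
    next
      assume D: "x_distinct m l"
      obtain p k where k: "l = add_mset p k" "\<not> m dvd p" "p > 0"
          "\<forall>q\<in>#k. q > 0 \<and> m dvd q" "n = p + sum_mset k" "[p = n] (mod m)"
        using x_distinct_nondvd_obtain[OF m D less.prems(2) 3(1)] .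
      have Dk: "x_distinct m k" using D k x_distinct_add_nondvd[OF m] by blast
      show "l \<in> SF n m"
      \<comment> \<open>A non-multiple below \<open>m\<close> is the remainder itself and was
        inserted; a larger one arose by adding \<open>m\<close>.\<close>
      proof (cases "p < m")
        case True
        then have "p = ?r" using k(6) by (simp add: cong_def)
        moreover from this have "partition_of k (n - ?r)"
          using k(4,5) by (metis partition_of_def add_diff_cancel_left')
        ultimately show ?thesis using iff1 Dk k(1) SF_not_dvd[OF m 3(2,1)] by blast
      next
        case False
        define q where "q = p - m"
        have q: "p = q + m" using False by (simp add: q_def)
        have nq: "\<not> m dvd q" using k(2) q by simp
        \<comment> \<open>The case \<open>p = m\<close> is excluded, so lowering by \<open>m\<close>
          leaves a genuine part.\<close>
        then have "q > 0" by (auto intro: Nat.gr0I)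
        then have "partition_of (add_mset q k) (n - m)"
          using k(4,5) q by (simp add: partition_of_def)
        moreover have "x_distinct m (add_mset q k)"
          using x_distinct_add_nondvd[OF m nq k(4)] Dk by blast
        moreover have "[q = n] (mod m)" using k(6) q by (simp add: cong_def)
        ultimately show ?thesis using iff2 k(1) q SF_not_dvd[OF m 3(2,1)] by blast
      qed
    qed
  qed
qed

lemma x_distinct_size_nondvd:
  assumes "m > 1" "x_distinct m l" "\<forall>p\<in>#l. p > 0"
  shows "size (filter_mset (\<lambda>p. \<not> m dvd p) l) \<le> 1"
proof (cases "\<exists>p\<in>#l. \<not> m dvd p")
  case True
  then obtain p k where k: "l = add_mset p k" "\<not> m dvd p" by (metis insert_DiffM)
  then have "\<forall>q\<in>#k. m dvd q"
    using x_distinct_nondvd_unique[OF assms(1)] assms(2,3) by auto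
  then have "filter_mset (\<lambda>p. \<not> m dvd p) k = {#}" by simp
  then show ?thesis using k by simp
next
  case False
  then have "filter_mset (\<lambda>p. \<not> m dvd p) l = {#}" by simp
  then show ?thesis by (metis size_empty zero_le)
qed

theorem theorem4:
  fixes m n :: nat and l :: "nat multiset"
  assumes "m > 1" and "n \<ge> 1" and "partition_of l n"
  shows "l \<in> SF n m \<longleftrightarrow>
    (\<forall>v. count (image_mset (x_val m) l) v \<le> 1) \<and>
    size (filter_mset (\<lambda>p. \<not> m dvd p) l) \<le> 1"
  using SF_iff_x_distinct[of m n l] x_distinct_size_nondvd[of m l] assms
  by (auto simp: partition_of_def x_distinct_def)

end
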